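(* Let $(K,J)$ be a 2-site, i.e. a 2-category $K$ equipped with a fully faithful singleton coverage $J$, and let $W_J$ be its class of weak equivalences. Then $(K,W_J)$ admits a bicategory of fractions; that is, the class $W_J$ of 1-arrows of $K$ satisfies conditions BF1, BF2, BF3 and BF4.
   Context: A 1-arrow $q\colon u\to x$ in a 2-category $K$ is called ff if for every object $z$ the post-composition functor $q_*\colon K(z,u)\to K(z,x)$ is fully faithful. A fully faithful singleton coverage on a 2-category $K$ is a class $J$ of 1-arrows such that: (i) $J$ contains the identity arrows and is closed under composition; (ii) for all $q\colon u\to x$ in $J$ and all 1-arrows $f\colon y\to x$ there are an object $v$, 1-arrows $k\colon v\to y$ and $h\colon v\to u$ with $k\in J$, and an invertible 2-arrow $q\circ h\Rightarrow f\circ k$; (iii) every $q\in J$ is ff. A 2-site is a 2-category equipped with a fully faithful singleton coverage. $K$ is not assumed to be small, and its 2-arrows need not be invertible. A 1-arrow $f\colon x\to y$ in $(K,J)$ is $J$-locally split if there are $q\colon u\to y$ in $J$, a 1-arrow $s\colon u\to x$ and an invertible 2-arrow between $f\circ s$ and $q$. A weak equivalence in $(K,J)$ is an ff 1-arrow that is $J$-locally split; $W_J$ is the class of weak equivalences. For a 2-category (or bicategory) $B$ and a class $W$ of 1-arrows, $(B,W)$ admits a bicategory of fractions if the following hold. BF1: $W$ contains all equivalences. BF2: $W$ is closed under composition and isomorphism (if $w\in W$ and there is an invertible 2-arrow $w\Rightarrow f$ then $f\in W$). BF3: for all $w\colon a'\to a$ and $f\colon c\to a$ with $w\in W$ there are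 an object $p$, 1-arrows $v\colon p\to c$ and $g\colon p\to a'$ with $v\in W$, and an invertible 2-arrow $w\circ g\Rightarrow f\circ v$. BF4: if $\alpha\colon w\circ f\Rightarrow w\circ g$ is a 2-arrow and $w\in W$, there is a 1-arrow $v\in W$ and a 2-arrow $\beta\colon f\circ v\Rightarrow g\circ v$ such that $\alpha\circ v=w\circ\beta$ (whiskering is denoted $\circ$). Moreover: when $\alpha$ is an isomorphism, $\beta$ is required to be an isomorphism too; and when $v',\beta'$ form another such pair, there exist 1-arrows $u,u'$ such that $v\circ u$ and $v'\circ u'$ are in $W$, and an invertible 2-arrow $\epsilon\colon v\circ u\Rightarrow v'\circ u'$, such that $(g\circ\epsilon)\cdot(\beta\circ u)=(\beta'\circ u')\cdot(f\circ\epsilon)$ as 2-arrows $f\circ v\circ u\Rightarrow g\circ v'\circ u'$. *)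

theory Defs
  imports Main
begin

text \<open>
  A 2-category is carried by three sets over arbitrary types, so that classes of 1-arrows are
  sets.  Compositions are written in the applicative order: \<open>g \<odot> f\<close> is the 1-arrow
  "first f, then g", and \<open>\<beta> \<bullet> \<alpha>\<close> is the vertical composite "first \<alpha>, then \<beta>".
  All operations are unspecified outside the composable elements of the carriers.
\<close>

record ('o, 'a, 'c) two_cat =
  Obj :: "'o set"
  Arr :: "'a set"
  Cell :: "'c set"
  src :: "'a \<Rightarrow> 'o"
  tgt :: "'a \<Rightarrow> 'o"
  ident1 :: "'o \<Rightarrow> 'a"
  comp1 :: "'a \<Rightarrow> 'a \<Rightarrow> 'a"  (infixr "\<odot>\<index>" 75)
  src2 :: "'c \<Rightarrow> 'a"
  tgt2 :: "'c \<Rightarrow> 'a"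
  ident2 :: "'a \<Rightarrow> 'c"
  vcomp :: "'c \<Rightarrow> 'c \<Rightarrow> 'c"  (infixr "\<bullet>\<index>" 65)
  hcomp :: "'c \<Rightarrow> 'c \<Rightarrow> 'c"  (infixr "\<star>\<index>" 75)

definition hom1 :: "('o, 'a, 'c, 'm) two_cat_scheme \<Rightarrow> 'o \<Rightarrow> 'o \<Rightarrow> 'a set" where
  "hom1 K x y = {f \<in> Arr K. src K f = x \<and> tgt K f = y}"

definition hom2 :: "('o, 'a, 'c, 'm) two_cat_scheme \<Rightarrow> 'a \<Rightarrow> 'a \<Rightarrow> 'c set" where
  "hom2 K f g = {\<alpha> \<in> Cell K. src2 K \<alpha> = f \<and> tgt2 K \<alpha> = g}"

locale two_category =
  fixes K :: "('o, 'a, 'c, 'm) two_cat_scheme" (structure)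
  assumes src_obj: "f \<in> Arr K \<Longrightarrow> src K f \<in> Obj K"
    and tgt_obj: "f \<in> Arr K \<Longrightarrow> tgt K f \<in> Obj K"
    and ident1_hom: "x \<in> Obj K \<Longrightarrow> ident1 K x \<in> hom1 K x x"
    and comp1_hom: "\<lbrakk>f \<in> hom1 K x y; g \<in> hom1 K y z\<rbrakk> \<Longrightarrow> g \<odot> f \<in> hom1 K x z"
    and comp1_ident_left: "f \<in> hom1 K x y \<Longrightarrow> ident1 K y \<odot> f = f"
    and comp1_ident_right: "f \<in> hom1 K x y \<Longrightarrow> f \<odot> ident1 K x = f"
    and comp1_assoc: "\<lbrakk>f \<in> hom1 K w x; g \<in> hom1 K x y; h \<in> hom1 K y z\<rbrakk>
      \<Longrightarrow> (h \<odot> g) \<odot> f = h \<odot> (g \<odot> f)"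
    and src2_arr: "\<alpha> \<in> Cell K \<Longrightarrow> src2 K \<alpha> \<in> Arr K"
    and tgt2_arr: "\<alpha> \<in> Cell K \<Longrightarrow> tgt2 K \<alpha> \<in> Arr K"
    and src_globular: "\<alpha> \<in> Cell K \<Longrightarrow> src K (src2 K \<alpha>) = src K (tgt2 K \<alpha>)"
    and tgt_globular: "\<alpha> \<in> Cell K \<Longrightarrow> tgt K (src2 K \<alpha>) = tgt K (tgt2 K \<alpha>)"
    and ident2_hom: "f \<in> Arr K \<Longrightarrow> ident2 K f \<in> hom2 K f f"
    and vcomp_hom: "\<lbrakk>\<alpha> \<in> hom2 K f g; \<beta> \<in> hom2 K g h\<rbrakk> \<Longrightarrow> \<beta> \<bullet> \<alpha> \<in> hom2 K f h"
    and vcomp_ident_left: "\<alpha> \<in> hom2 K f g \<Longrightarrow> ident2 K g \<bullet> \<alpha> = \<alpha>"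
    and vcomp_ident_right: "\<alpha> \<in> hom2 K f g \<Longrightarrow> \<alpha> \<bullet> ident2 K f = \<alpha>"
    and vcomp_assoc: "\<lbrakk>\<alpha> \<in> hom2 K e f; \<beta> \<in> hom2 K f g; \<gamma> \<in> hom2 K g h\<rbrakk>
      \<Longrightarrow> (\<gamma> \<bullet> \<beta>) \<bullet> \<alpha> = \<gamma> \<bullet> (\<beta> \<bullet> \<alpha>)"
    and hcomp_hom: "\<lbrakk>f \<in> hom1 K x y; g \<in> hom1 K y z; \<alpha> \<in> hom2 K f f'; \<beta> \<in> hom2 K g g'\<rbrakk>
      \<Longrightarrow> \<beta> \<star> \<alpha> \<in> hom2 K (g \<odot> f) (g' \<odot> f')"
    and hcomp_ident2: "\<lbrakk>f \<in> hom1 K x y; g \<in> hom1 K y z\<rbrakk>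
      \<Longrightarrow> ident2 K g \<star> ident2 K f = ident2 K (g \<odot> f)"
    and interchange: "\<lbrakk>f \<in> hom1 K x y; \<alpha> \<in> hom2 K f f'; \<alpha>' \<in> hom2 K f' f'';
        g \<in> hom1 K y z; \<beta> \<in> hom2 K g g'; \<beta>' \<in> hom2 K g' g''\<rbrakk>
      \<Longrightarrow> (\<beta>' \<bullet> \<beta>) \<star> (\<alpha>' \<bullet> \<alpha>) = (\<beta>' \<star> \<alpha>') \<bullet> (\<beta> \<star> \<alpha>)"
    and hcomp_ident_left: "\<lbrakk>f \<in> hom1 K x y; \<alpha> \<in> hom2 K f f'\<rbrakk>
      \<Longrightarrow> ident2 K (ident1 K y) \<star> \<alpha> = \<alpha>"
    and hcomp_ident_right: "\<lbrakk>f \<in> hom1 K x y; \<alpha> \<in> hom2 K f f'\<rbrakk>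
      \<Longrightarrow> \<alpha> \<star> ident2 K (ident1 K x) = \<alpha>"
    and hcomp_assoc: "\<lbrakk>f \<in> hom1 K w x; g \<in> hom1 K x y; h \<in> hom1 K y z;
        \<alpha> \<in> hom2 K f f'; \<beta> \<in> hom2 K g g'; \<gamma> \<in> hom2 K h h'\<rbrakk>
      \<Longrightarrow> (\<gamma> \<star> \<beta>) \<star> \<alpha> = \<gamma> \<star> (\<beta> \<star> \<alpha>)"

definition whisker_left :: "('o, 'a, 'c, 'm) two_cat_scheme \<Rightarrow> 'a \<Rightarrow> 'c \<Rightarrow> 'c"
  (infixr "\<rhd>\<index>" 75) where
  "w \<rhd>\<^bsub>K\<^esub> \<alpha> = ident2 K w \<star>\<^bsub>K\<^esub> \<alpha>"

definition whisker_right :: "('o, 'a, 'c, 'm) two_cat_scheme \<Rightarrow> 'c \<Rightarrow> 'a \<Rightarrow> 'c"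
  (infixl "\<lhd>\<index>" 75) where
  "\<alpha> \<lhd>\<^bsub>K\<^esub> v = \<alpha> \<star>\<^bsub>K\<^esub> ident2 K v"

definition iso2 :: "('o, 'a, 'c, 'm) two_cat_scheme \<Rightarrow> 'a \<Rightarrow> 'a \<Rightarrow> 'c set" where
  "iso2 K f g = {\<alpha> \<in> hom2 K f g.
     \<exists>\<beta> \<in> hom2 K g f. \<beta> \<bullet>\<^bsub>K\<^esub> \<alpha> = ident2 K f \<and> \<alpha> \<bullet>\<^bsub>K\<^esub> \<beta> = ident2 K g}"

definition isomorphic1 :: "('o, 'a, 'c, 'm) two_cat_scheme \<Rightarrow> 'a \<Rightarrow> 'a \<Rightarrow> bool" where
  "isomorphic1 K f g \<longleftrightarrow> (\<exists>\<alpha>. \<alpha> \<in> iso2 K f g)"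

definition equivalence1 :: "('o, 'a, 'c, 'm) two_cat_scheme \<Rightarrow> 'a \<Rightarrow> bool" where
  "equivalence1 K e \<longleftrightarrow> (\<exists>x \<in> Obj K. \<exists>y \<in> Obj K. e \<in> hom1 K x y \<and>
     (\<exists>e' \<in> hom1 K y x. isomorphic1 K (e' \<odot>\<^bsub>K\<^esub> e) (ident1 K x) \<and>
                       isomorphic1 K (e \<odot>\<^bsub>K\<^esub> e') (ident1 K y)))"

text \<open>
  The post-composition functor of \<open>q : u \<rightarrow> x\<close> sends a 1-arrow \<open>f : z \<rightarrow> u\<close> to \<open>q \<odot> f\<close> and a
  2-arrow \<open>\<alpha>\<close> to \<open>q \<rhd> \<alpha>\<close>; it is fully faithful iff it is bijective on each hom-set
  of the hom-category from z to u.
\<close>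

definition ff :: "('o, 'a, 'c, 'm) two_cat_scheme \<Rightarrow> 'a \<Rightarrow> bool" where
  "ff K q \<longleftrightarrow> q \<in> Arr K \<and>
     (\<forall>z \<in> Obj K. \<forall>f \<in> hom1 K z (src K q). \<forall>g \<in> hom1 K z (src K q).
        bij_betw (\<lambda>\<alpha>. q \<rhd>\<^bsub>K\<^esub> \<alpha>) (hom2 K f g) (hom2 K (q \<odot>\<^bsub>K\<^esub> f) (q \<odot>\<^bsub>K\<^esub> g)))"

definition ff_singleton_coverage ::
  "('o, 'a, 'c, 'm) two_cat_scheme \<Rightarrow> 'a set \<Rightarrow> bool" where
  "ff_singleton_coverage K J \<longleftrightarrow>
     J \<subseteq> Arr K \<and>
     (\<forall>x \<in> Obj K. ident1 K x \<in> J) \<and>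
     (\<forall>p \<in> J. \<forall>q \<in> J. tgt K p = src K q \<longrightarrow> q \<odot>\<^bsub>K\<^esub> p \<in> J) \<and>
     (\<forall>u \<in> Obj K. \<forall>x \<in> Obj K. \<forall>y \<in> Obj K. \<forall>q \<in> hom1 K u x. \<forall>f \<in> hom1 K y x.
        q \<in> J \<longrightarrow>
        (\<exists>v \<in> Obj K. \<exists>k \<in> hom1 K v y. \<exists>h \<in> hom1 K v u.
           k \<in> J \<and> isomorphic1 K (q \<odot>\<^bsub>K\<^esub> h) (f \<odot>\<^bsub>K\<^esub> k))) \<and>
     (\<forall>q \<in> J. ff K q)"

definition two_site :: "('o, 'a, 'c, 'm) two_cat_scheme \<Rightarrow> 'a set \<Rightarrow> bool" where
  "two_site K J \<longleftrightarrow> two_category K \<and> ff_singleton_coverage K J"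

definition locally_split ::
  "('o, 'a, 'c, 'm) two_cat_scheme \<Rightarrow> 'a set \<Rightarrow> 'a \<Rightarrow> bool" where
  "locally_split K J f \<longleftrightarrow> f \<in> Arr K \<and>
     (\<exists>u \<in> Obj K. \<exists>q \<in> hom1 K u (tgt K f). \<exists>s \<in> hom1 K u (src K f).
        q \<in> J \<and> isomorphic1 K (f \<odot>\<^bsub>K\<^esub> s) q)"

definition weak_equivalences ::
  "('o, 'a, 'c, 'm) two_cat_scheme \<Rightarrow> 'a set \<Rightarrow> 'a set" where
  "weak_equivalences K J = {f \<in> Arr K. ff K f \<and> locally_split K J f}"

definition BF1 :: "('o, 'a, 'c, 'm) two_cat_scheme \<Rightarrow> 'a set \<Rightarrow> bool" where
  "BF1 K W \<longleftrightarrow> (\<forall>e. equivalence1 K e \<longrightarrow> e \<in> W)"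

definition BF2 :: "('o, 'a, 'c, 'm) two_cat_scheme \<Rightarrow> 'a set \<Rightarrow> bool" where
  "BF2 K W \<longleftrightarrow>
     (\<forall>v \<in> W. \<forall>w \<in> W. tgt K v = src K w \<longrightarrow> w \<odot>\<^bsub>K\<^esub> v \<in> W) \<and>
     (\<forall>w \<in> W. \<forall>f \<in> Arr K. isomorphic1 K w f \<longrightarrow> f \<in> W)"

definition BF3 :: "('o, 'a, 'c, 'm) two_cat_scheme \<Rightarrow> 'a set \<Rightarrow> bool" where
  "BF3 K W \<longleftrightarrow>
     (\<forall>a \<in> Obj K. \<forall>a' \<in> Obj K. \<forall>c \<in> Obj K. \<forall>w \<in> hom1 K a' a. \<forall>f \<in> hom1 K c a.
        w \<in> W \<longrightarrow>
        (\<exists>p \<in> Obj K. \<exists>v \<in> hom1 K p c. \<exists>g \<in> hom1 K p a'.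
           v \<in> W \<and> isomorphic1 K (w \<odot>\<^bsub>K\<^esub> g) (f \<odot>\<^bsub>K\<^esub> v)))"

definition BF4_pair ::
  "('o, 'a, 'c, 'm) two_cat_scheme \<Rightarrow> 'a set \<Rightarrow> 'a \<Rightarrow> 'a \<Rightarrow> 'a \<Rightarrow> 'c \<Rightarrow> 'a \<Rightarrow> 'c \<Rightarrow> bool" where
  "BF4_pair K W w f g \<alpha> v \<beta> \<longleftrightarrow>
     v \<in> Arr K \<and> tgt K v = src K f \<and> v \<in> W \<and>
     \<beta> \<in> hom2 K (f \<odot>\<^bsub>K\<^esub> v) (g \<odot>\<^bsub>K\<^esub> v) \<and>
     \<alpha> \<lhd>\<^bsub>K\<^esub> v = w \<rhd>\<^bsub>K\<^esub> \<beta>"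

text \<open>
  In the compatibility equation of BF4 both sides are 2-arrows from \<open>f \<odot> v \<odot> u\<close> to
  \<open>g \<odot> v' \<odot> u'\<close>; no associators occur because composition of 1-arrows is strictly associative.
  The other pair \<open>(v', \<beta>')\<close> is compared with the pair \<open>(v, \<beta>)\<close> whose existence is asserted, and
  \<open>\<beta>'\<close> is not required to be invertible.
\<close>

definition BF4 :: "('o, 'a, 'c, 'm) two_cat_scheme \<Rightarrow> 'a set \<Rightarrow> bool" where
  "BF4 K W \<longleftrightarrow>
     (\<forall>a \<in> Obj K. \<forall>a' \<in> Obj K. \<forall>b \<in> Obj K.
      \<forall>w \<in> hom1 K a' a. \<forall>f \<in> hom1 K b a'. \<forall>g \<in> hom1 K b a'.
      \<forall>\<alpha> \<in> hom2 K (w \<odot>\<^bsub>K\<^esub> f) (w \<odot>\<^bsub>K\<^esub> g).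
        w \<in> W \<longrightarrow>
        (\<exists>v \<beta>. BF4_pair K W w f g \<alpha> v \<beta> \<and>
           (\<alpha> \<in> iso2 K (w \<odot>\<^bsub>K\<^esub> f) (w \<odot>\<^bsub>K\<^esub> g) \<longrightarrow> \<beta> \<in> iso2 K (f \<odot>\<^bsub>K\<^esub> v) (g \<odot>\<^bsub>K\<^esub> v)) \<and>
           (\<forall>v' \<beta>'. BF4_pair K W w f g \<alpha> v' \<beta>' \<longrightarrow>
              (\<exists>d \<in> Obj K. \<exists>u \<in> hom1 K d (src K v). \<exists>u' \<in> hom1 K d (src K v').
                 v \<odot>\<^bsub>K\<^esub> u \<in> W \<and> v' \<odot>\<^bsub>K\<^esub> u' \<in> W \<and>
                 (\<exists>\<epsilon> \<in> iso2 K (v \<odot>\<^bsub>K\<^esub> u) (v' \<odot>\<^bsub>K\<^esub> u').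
                    (g \<rhd>\<^bsub>K\<^esub> \<epsilon>) \<bullet>\<^bsub>K\<^esub> (\<beta> \<lhd>\<^bsub>K\<^esub> u) = (\<beta>' \<lhd>\<^bsub>K\<^esub> u') \<bullet>\<^bsub>K\<^esub> (f \<rhd>\<^bsub>K\<^esub> \<epsilon>))))))"

definition admits_bicategory_of_fractions ::
  "('o, 'a, 'c, 'm) two_cat_scheme \<Rightarrow> 'a set \<Rightarrow> bool" where
  "admits_bicategory_of_fractions K W \<longleftrightarrow>
     W \<subseteq> Arr K \<and> BF1 K W \<and> BF2 K W \<and> BF3 K W \<and> BF4 K W"

end

theory Submission
  imports Defs
begin

text \<open>
  Fully faithful 1-arrows are closed under isomorphism and composition, and locally split ones
  compose because a cover can be pulled back along a local section.  Since a weak equivalence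
  \<open>w\<close> is itself fully faithful, \<open>\<alpha> : w \<odot> f \<Rightarrow> w \<odot> g\<close> lifts
  uniquely along \<open>w\<close>, so BF4 holds with \<open>v\<close> an identity, and every other solution
  is a whiskering of this one.
\<close>

context two_category
begin

section \<open>Typing of 1-arrows and 2-arrows, and the calculus of whiskering\<close>

lemma hom2_hom1:
  assumes "\<alpha> \<in> hom2 K f g" "f \<in> hom1 K x y"
  shows "g \<in> hom1 K x y"
  using assms src_globular tgt_globular tgt2_arr unfolding hom1_def hom2_def by fastforce

lemma hom1_arr: "f \<in> hom1 K x y \<Longrightarrow> f \<in> Arr K"
  by (simp add: hom1_def)

lemma hom1_obj:
  assumes "f \<in> hom1 K x y"
  shows "x \<in> Obj K" "y \<in> Obj K"
  using assms src_obj tgt_obj unfolding hom1_def by auto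

lemma ident2_hom1: "f \<in> hom1 K x y \<Longrightarrow> ident2 K f \<in> hom2 K f f"
  by (simp add: ident2_hom hom1_arr)

lemma whisker_left_hom:
  assumes "f \<in> hom1 K x y" "w \<in> hom1 K y z" "\<alpha> \<in> hom2 K f g"
  shows "w \<rhd> \<alpha> \<in> hom2 K (w \<odot> f) (w \<odot> g)"
  unfolding whisker_left_def using hcomp_hom[OF assms(1,2,3) ident2_hom1[OF assms(2)]] .

lemma whisker_right_hom:
  assumes "v \<in> hom1 K x y" "f \<in> hom1 K y z" "\<alpha> \<in> hom2 K f g"
  shows "\<alpha> \<lhd> v \<in> hom2 K (f \<odot> v) (g \<odot> v)"
  unfolding whisker_right_def using hcomp_hom[OF assms(1,2) ident2_hom1[OF assms(1)] assms(3)] .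

lemma whisker_left_ident2:
  assumes "f \<in> hom1 K x y" "w \<in> hom1 K y z"
  shows "w \<rhd> ident2 K f = ident2 K (w \<odot> f)"
  unfolding whisker_left_def using hcomp_ident2[OF assms] .

lemma whisker_right_ident2:
  assumes "v \<in> hom1 K x y" "f \<in> hom1 K y z"
  shows "ident2 K f \<lhd> v = ident2 K (f \<odot> v)"
  unfolding whisker_right_def using hcomp_ident2[OF assms] .

lemma whisker_left_vcomp:
  assumes "f \<in> hom1 K x y" "w \<in> hom1 K y z" "\<alpha> \<in> hom2 K f g" "\<beta> \<in> hom2 K g h"
  shows "w \<rhd> (\<beta> \<bullet> \<alpha>) = (w \<rhd> \<beta>) \<bullet> (w \<rhd> \<alpha>)"
  unfolding whisker_left_def
  using interchange[OF assms(1,3,4,2) ident2_hom1[OF assms(2)] ident2_hom1[OF assms(2)]]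
    vcomp_ident_left[OF ident2_hom1[OF assms(2)]] by simp

lemma whisker_right_vcomp:
  assumes "v \<in> hom1 K x y" "f \<in> hom1 K y z" "\<alpha> \<in> hom2 K f g" "\<beta> \<in> hom2 K g h"
  shows "(\<beta> \<bullet> \<alpha>) \<lhd> v = (\<beta> \<lhd> v) \<bullet> (\<alpha> \<lhd> v)"
  unfolding whisker_right_def
  using interchange[OF assms(1) ident2_hom1[OF assms(1)] ident2_hom1[OF assms(1)] assms(2-4)]
    vcomp_ident_left[OF ident2_hom1[OF assms(1)]] by simp

text \<open>Both sides equal \<open>\<theta> \<star> \<alpha>\<close>: padding the two factors with
  identity 2-arrows on opposite sides and applying interchange gives one or the other. This
  naturality of \<open>\<theta>\<close> is what relates whiskering with \<open>p\<close> to
  whiskering with \<open>q\<close>.\<close>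

lemma whisker_exchange:
  assumes f: "f \<in> hom1 K x y" and p: "p \<in> hom1 K y z"
    and \<alpha>: "\<alpha> \<in> hom2 K f g" and \<theta>: "\<theta> \<in> hom2 K p q"
  shows "(q \<rhd> \<alpha>) \<bullet> (\<theta> \<lhd> f) = (\<theta> \<lhd> g) \<bullet> (p \<rhd> \<alpha>)"
proof -
  have g: "g \<in> hom1 K x y" and q: "q \<in> hom1 K y z"
    using hom2_hom1[OF \<alpha> f] hom2_hom1[OF \<theta> p] .
  have "(q \<rhd> \<alpha>) \<bullet> (\<theta> \<lhd> f) = (ident2 K q \<bullet> \<theta>) \<star> (\<alpha> \<bullet> ident2 K f)"
    unfolding whisker_left_def whisker_right_def
    using interchange[OF f ident2_hom1[OF f] \<alpha> p \<theta> ident2_hom1[OF q]] by simp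
  also have "\<dots> = (\<theta> \<bullet> ident2 K p) \<star> (ident2 K g \<bullet> \<alpha>)"
    by (simp add: vcomp_ident_left[OF \<theta>] vcomp_ident_right[OF \<theta>]
        vcomp_ident_left[OF \<alpha>] vcomp_ident_right[OF \<alpha>])
  also have "\<dots> = (\<theta> \<lhd> g) \<bullet> (p \<rhd> \<alpha>)"
    unfolding whisker_left_def whisker_right_def
    using interchange[OF f \<alpha> ident2_hom1[OF g] p ident2_hom1[OF p] \<theta>] by simp
  finally show ?thesis .
qed

lemma whisker_left_comp1:
  assumes "f \<in> hom1 K w x" "p \<in> hom1 K x y" "q \<in> hom1 K y z" "\<alpha> \<in> hom2 K f g"
  shows "(q \<odot> p) \<rhd> \<alpha> = q \<rhd> (p \<rhd> \<alpha>)"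
  unfolding whisker_left_def hcomp_ident2[OF assms(2,3), symmetric]
  using hcomp_assoc[OF assms(1-4) ident2_hom1[OF assms(2)] ident2_hom1[OF assms(3)]] .

lemma whisker_left_right:
  assumes "v \<in> hom1 K w x" "f \<in> hom1 K x y" "q \<in> hom1 K y z" "\<alpha> \<in> hom2 K f g"
  shows "(q \<rhd> \<alpha>) \<lhd> v = q \<rhd> (\<alpha> \<lhd> v)"
  unfolding whisker_left_def whisker_right_def
  using hcomp_assoc[OF assms(1-3) ident2_hom1[OF assms(1)] assms(4) ident2_hom1[OF assms(3)]] .

section \<open>Invertible 2-arrows and isomorphism of 1-arrows\<close>

lemma iso2_hom2: "\<alpha> \<in> iso2 K f g \<Longrightarrow> \<alpha> \<in> hom2 K f g"
  by (simp add: iso2_def)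

lemma iso2E:
  assumes "\<alpha> \<in> iso2 K f g"
  obtains \<beta> where "\<beta> \<in> iso2 K g f" "\<beta> \<bullet> \<alpha> = ident2 K f" "\<alpha> \<bullet> \<beta> = ident2 K g"
  using assms unfolding iso2_def by blast

lemma ident2_iso2: "f \<in> hom1 K x y \<Longrightarrow> ident2 K f \<in> iso2 K f f"
  unfolding iso2_def using ident2_hom1 vcomp_ident_left by fastforce

lemma iso2_vcomp:
  assumes "\<alpha> \<in> iso2 K f g" "\<beta> \<in> iso2 K g h"
  shows "\<beta> \<bullet> \<alpha> \<in> iso2 K f h"
proof -
  obtain \<alpha>' where a': "\<alpha>' \<in> iso2 K g f" "\<alpha>' \<bullet> \<alpha> = ident2 K f" "\<alpha> \<bullet> \<alpha>' = ident2 K g"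
    using iso2E[OF assms(1)] .
  obtain \<beta>' where b': "\<beta>' \<in> iso2 K h g" "\<beta>' \<bullet> \<beta> = ident2 K g" "\<beta> \<bullet> \<beta>' = ident2 K h"
    using iso2E[OF assms(2)] .
  note h = iso2_hom2[OF assms(1)] iso2_hom2[OF assms(2)] iso2_hom2[OF a'(1)] iso2_hom2[OF b'(1)]
  have "(\<alpha>' \<bullet> \<beta>') \<bullet> (\<beta> \<bullet> \<alpha>) = \<alpha>' \<bullet> ((\<beta>' \<bullet> \<beta>) \<bullet> \<alpha>)"
    using vcomp_assoc[OF vcomp_hom[OF h(1,2)] h(4,3)] vcomp_assoc[OF h(1,2,4)] by simp
  then have 1: "(\<alpha>' \<bullet> \<beta>') \<bullet> (\<beta> \<bullet> \<alpha>) = ident2 K f"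
    using a' b' vcomp_ident_left[OF h(1)] by simp
  have "(\<beta> \<bullet> \<alpha>) \<bullet> (\<alpha>' \<bullet> \<beta>') = \<beta> \<bullet> ((\<alpha> \<bullet> \<alpha>') \<bullet> \<beta>')"
    using vcomp_assoc[OF vcomp_hom[OF h(4,3)] h(1,2)] vcomp_assoc[OF h(4,3,1)] by simp
  then have 2: "(\<beta> \<bullet> \<alpha>) \<bullet> (\<alpha>' \<bullet> \<beta>') = ident2 K h"
    using a' b' vcomp_ident_left[OF h(4)] by simp
  show ?thesis
    unfolding iso2_def using 1 2 vcomp_hom[OF h(1,2)] vcomp_hom[OF h(4,3)] by blast
qed

lemma whisker_left_iso2:
  assumes f: "f \<in> hom1 K x y" and w: "w \<in> hom1 K y z" and \<alpha>: "\<alpha> \<in> iso2 K f g"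
  shows "w \<rhd> \<alpha> \<in> iso2 K (w \<odot> f) (w \<odot> g)"
proof -
  obtain \<beta> where \<beta>: "\<beta> \<in> iso2 K g f" "\<beta> \<bullet> \<alpha> = ident2 K f" "\<alpha> \<bullet> \<beta> = ident2 K g"
    using iso2E[OF \<alpha>] .
  note h = iso2_hom2[OF \<alpha>] iso2_hom2[OF \<beta>(1)]
  have g: "g \<in> hom1 K x y" using hom2_hom1[OF h(1) f] .
  have "(w \<rhd> \<beta>) \<bullet> (w \<rhd> \<alpha>) = ident2 K (w \<odot> f)" "(w \<rhd> \<alpha>) \<bullet> (w \<rhd> \<beta>) = ident2 K (w \<odot> g)"
    using whisker_left_vcomp[OF f w h] whisker_left_vcomp[OF g w h(2,1)] \<beta>
      whisker_left_ident2[OF f w] whisker_left_ident2[OF g w] by simp_all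
  then show ?thesis
    unfolding iso2_def using whisker_left_hom[OF f w h(1)] whisker_left_hom[OF g w h(2)] by blast
qed

lemma whisker_right_iso2:
  assumes v: "v \<in> hom1 K x y" and f: "f \<in> hom1 K y z" and \<alpha>: "\<alpha> \<in> iso2 K f g"
  shows "\<alpha> \<lhd> v \<in> iso2 K (f \<odot> v) (g \<odot> v)"
proof -
  obtain \<beta> where \<beta>: "\<beta> \<in> iso2 K g f" "\<beta> \<bullet> \<alpha> = ident2 K f" "\<alpha> \<bullet> \<beta> = ident2 K g"
    using iso2E[OF \<alpha>] .
  note h = iso2_hom2[OF \<alpha>] iso2_hom2[OF \<beta>(1)]
  have g: "g \<in> hom1 K y z" using hom2_hom1[OF h(1) f] .
  have "(\<beta> \<lhd> v) \<bullet> (\<alpha> \<lhd> v) = ident2 K (f \<odot> v)" "(\<alpha> \<lhd> v) \<bullet> (\<beta> \<lhd> v) = ident2 K (g \<odot> v)"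
    using whisker_right_vcomp[OF v f h] whisker_right_vcomp[OF v g h(2,1)] \<beta>
      whisker_right_ident2[OF v f] whisker_right_ident2[OF v g] by simp_all
  then show ?thesis
    unfolding iso2_def using whisker_right_hom[OF v f h(1)] whisker_right_hom[OF v g h(2)] by blast
qed

lemma isomorphic1_refl: "f \<in> hom1 K x y \<Longrightarrow> isomorphic1 K f f"
  unfolding isomorphic1_def using ident2_iso2 by blast

lemma isomorphic1_sym: "isomorphic1 K f g \<Longrightarrow> isomorphic1 K g f"
  unfolding isomorphic1_def by (meson iso2E)

lemma isomorphic1_trans [trans]:
  "isomorphic1 K f g \<Longrightarrow> isomorphic1 K g h \<Longrightarrow> isomorphic1 K f h"
  unfolding isomorphic1_def using iso2_vcomp by blast

lemma isomorphic1_hom1: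
  assumes "isomorphic1 K f g" "f \<in> hom1 K x y"
  shows "g \<in> hom1 K x y"
  using assms hom2_hom1 iso2_hom2 unfolding isomorphic1_def by blast

lemma isomorphic1_comp1_left:
  "\<lbrakk>isomorphic1 K f g; f \<in> hom1 K x y; w \<in> hom1 K y z\<rbrakk> \<Longrightarrow> isomorphic1 K (w \<odot> f) (w \<odot> g)"
  unfolding isomorphic1_def using whisker_left_iso2 by blast

lemma isomorphic1_comp1_right:
  "\<lbrakk>isomorphic1 K f g; f \<in> hom1 K y z; v \<in> hom1 K x y\<rbrakk> \<Longrightarrow> isomorphic1 K (f \<odot> v) (g \<odot> v)"
  unfolding isomorphic1_def using whisker_right_iso2 by blast

section \<open>Bijections between sets of 2-arrows, and fully faithful 1-arrows\<close>

lemma bij_betw_vcomp_left: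
  assumes "\<alpha> \<in> iso2 K g h"
  shows "bij_betw (\<lambda>\<gamma>. \<alpha> \<bullet> \<gamma>) (hom2 K f g) (hom2 K f h)"
proof -
  obtain \<beta> where \<beta>: "\<beta> \<in> iso2 K h g" "\<beta> \<bullet> \<alpha> = ident2 K g" "\<alpha> \<bullet> \<beta> = ident2 K h"
    using iso2E[OF assms] .
  note h = iso2_hom2[OF assms] iso2_hom2[OF \<beta>(1)]
  show ?thesis
  proof (rule bij_betw_byWitness[where f' = "\<lambda>\<gamma>. \<beta> \<bullet> \<gamma>"])
    show "\<forall>\<gamma> \<in> hom2 K f g. \<beta> \<bullet> (\<alpha> \<bullet> \<gamma>) = \<gamma>"
      using vcomp_assoc[OF _ h] \<beta>(2) vcomp_ident_left by metis
    show "\<forall>\<gamma> \<in> hom2 K f h. \<alpha> \<bullet> (\<beta> \<bullet> \<gamma>) = \<gamma>"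
      using vcomp_assoc[OF _ h(2,1)] \<beta>(3) vcomp_ident_left by metis
  qed (use vcomp_hom h in auto)
qed

lemma bij_betw_vcomp_right:
  assumes "\<alpha> \<in> iso2 K e f"
  shows "bij_betw (\<lambda>\<gamma>. \<gamma> \<bullet> \<alpha>) (hom2 K f g) (hom2 K e g)"
proof -
  obtain \<beta> where \<beta>: "\<beta> \<in> iso2 K f e" "\<beta> \<bullet> \<alpha> = ident2 K e" "\<alpha> \<bullet> \<beta> = ident2 K f"
    using iso2E[OF assms] .
  note h = iso2_hom2[OF assms] iso2_hom2[OF \<beta>(1)]
  show ?thesis
  proof (rule bij_betw_byWitness[where f' = "\<lambda>\<gamma>. \<gamma> \<bullet> \<beta>"])
    show "\<forall>\<gamma> \<in> hom2 K f g. (\<gamma> \<bullet> \<alpha>) \<bullet> \<beta> = \<gamma>"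
      using vcomp_assoc[OF h(2,1)] \<beta>(3) vcomp_ident_right by metis
    show "\<forall>\<gamma> \<in> hom2 K e g. (\<gamma> \<bullet> \<beta>) \<bullet> \<alpha> = \<gamma>"
      using vcomp_assoc[OF h] \<beta>(2) vcomp_ident_right by metis
  qed (use vcomp_hom h in auto)
qed

lemma ff_iff:
  assumes "q \<in> hom1 K u x"
  shows "ff K q \<longleftrightarrow> (\<forall>z. \<forall>f \<in> hom1 K z u. \<forall>g \<in> hom1 K z u.
    bij_betw (\<lambda>\<alpha>. q \<rhd> \<alpha>) (hom2 K f g) (hom2 K (q \<odot> f) (q \<odot> g)))"
proof -
  have "src K q = u" "q \<in> Arr K"
    using assms by (simp_all add: hom1_def)
  then show ?thesis
    unfolding ff_def using hom1_obj(1) by blast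
qed

lemma ff_ident1:
  assumes "x \<in> Obj K"
  shows "ff K (ident1 K x)"
  unfolding ff_iff[OF ident1_hom[OF assms]]
proof (intro allI ballI)
  fix z f g assume f: "f \<in> hom1 K z x" and g: "g \<in> hom1 K z x"
  have "bij_betw (\<lambda>\<alpha>. \<alpha>) (hom2 K f g) (hom2 K f g)"
    by (simp add: bij_betw_def)
  then show "bij_betw (\<lambda>\<alpha>. ident1 K x \<rhd> \<alpha>) (hom2 K f g)
      (hom2 K (ident1 K x \<odot> f) (ident1 K x \<odot> g))"
    unfolding comp1_ident_left[OF f] comp1_ident_left[OF g]
    \<comment> \<open>The two maps are known to agree only on \<open>hom2 K f g\<close>, because the
      unit law for \<open>\<star>\<close> is available only there. Hence a congruence restricted to
      the domain is used instead of an equation between functions.\<close>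
    by (rule bij_betw_cong[THEN iffD1, rotated])
      (simp add: whisker_left_def hcomp_ident_left[OF f])
qed

text \<open>The post-composition functor of \<open>q \<odot> p\<close> is that of \<open>p\<close>
  followed by that of \<open>q\<close>, strictly so by associativity, and bijections on hom-sets
  compose.\<close>

lemma ff_comp1:
  assumes p: "p \<in> hom1 K x y" and q: "q \<in> hom1 K y z" and "ff K p" "ff K q"
  shows "ff K (q \<odot> p)"
  unfolding ff_iff[OF comp1_hom[OF p q]]
proof (intro allI ballI)
  fix t f g assume f: "f \<in> hom1 K t x" and g: "g \<in> hom1 K t x"
  have "bij_betw ((\<lambda>\<alpha>. q \<rhd> \<alpha>) \<circ> (\<lambda>\<alpha>. p \<rhd> \<alpha>)) (hom2 K f g)
      (hom2 K (q \<odot> (p \<odot> f)) (q \<odot> (p \<odot> g)))"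
  proof (rule bij_betw_trans)
    show "bij_betw (\<lambda>\<alpha>. p \<rhd> \<alpha>) (hom2 K f g) (hom2 K (p \<odot> f) (p \<odot> g))"
      using assms(3) f g unfolding ff_iff[OF p] by blast
    show "bij_betw (\<lambda>\<alpha>. q \<rhd> \<alpha>) (hom2 K (p \<odot> f) (p \<odot> g))
        (hom2 K (q \<odot> (p \<odot> f)) (q \<odot> (p \<odot> g)))"
      using assms(4) comp1_hom[OF f p] comp1_hom[OF g p] unfolding ff_iff[OF q] by blast
  qed
  then show "bij_betw (\<lambda>\<alpha>. (q \<odot> p) \<rhd> \<alpha>) (hom2 K f g)
      (hom2 K ((q \<odot> p) \<odot> f) ((q \<odot> p) \<odot> g))"
    unfolding comp1_assoc[OF f p q] comp1_assoc[OF g p q]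
    by (rule bij_betw_cong[THEN iffD1, rotated]) (simp add: whisker_left_comp1[OF f p q])
qed

text \<open>
  By exchange with \<open>\<theta> : p \<cong> q\<close>, whiskering with \<open>q\<close> is whiskering with
  \<open>p\<close> conjugated by components of \<open>\<theta>\<close>.
\<close>

lemma ff_isomorphic1:
  assumes p: "p \<in> hom1 K u x" and "ff K p" and "isomorphic1 K p q"
  shows "ff K q"
proof -
  obtain \<theta> where \<theta>: "\<theta> \<in> iso2 K p q"
    using assms(3) unfolding isomorphic1_def by blast
  have q: "q \<in> hom1 K u x"
    using isomorphic1_hom1[OF assms(3) p] .
  show ?thesis
    unfolding ff_iff[OF q]
  proof (intro allI ballI)
    fix z f g assume f: "f \<in> hom1 K z u" and g: "g \<in> hom1 K z u"
    have "bij_betw (\<lambda>\<alpha>. p \<rhd> \<alpha>) (hom2 K f g) (hom2 K (p \<odot> f) (p \<odot> g))"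
      using assms(2) f g unfolding ff_iff[OF p] by blast
    from bij_betw_trans[OF this bij_betw_vcomp_left[OF whisker_right_iso2[OF g p \<theta>]]]
    have "bij_betw (\<lambda>\<alpha>. (\<theta> \<lhd> g) \<bullet> (p \<rhd> \<alpha>)) (hom2 K f g) (hom2 K (p \<odot> f) (q \<odot> g))"
      by (simp add: comp_def)
    then have comp: "bij_betw ((\<lambda>\<gamma>. \<gamma> \<bullet> (\<theta> \<lhd> f)) \<circ> (\<lambda>\<alpha>. q \<rhd> \<alpha>))
        (hom2 K f g) (hom2 K (p \<odot> f) (q \<odot> g))"
      by (rule bij_betw_cong[THEN iffD1, rotated])
        (simp add: whisker_exchange[OF f p _ iso2_hom2[OF \<theta>]])
    have "(\<lambda>\<alpha>. q \<rhd> \<alpha>) ` hom2 K f g \<subseteq> hom2 K (q \<odot> f) (q \<odot> g)"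
      using whisker_left_hom[OF f q] by (rule image_subsetI)
    \<comment> \<open>Precomposition with the invertible \<open>\<theta> \<lhd> f\<close> is a
      bijection, so it can be cancelled from the composite in \<open>comp\<close>.\<close>
    from bij_betw_comp_iff2[OF bij_betw_vcomp_right[OF whisker_right_iso2[OF f p \<theta>]] this]
    show "bij_betw (\<lambda>\<alpha>. q \<rhd> \<alpha>) (hom2 K f g) (hom2 K (q \<odot> f) (q \<odot> g))"
      using comp by (rule iffD2)
  qed
qed

text \<open>On hom-sets this is the two-out-of-six property of bijections for whiskering with
  \<open>e\<close>, then \<open>e'\<close>, then \<open>e\<close> again. The middle map is shown to
  be a bijection first, and the first map follows by cancellation.\<close>

lemma ff_if_ff_comp1:
  assumes e: "e \<in> hom1 K x y" and e': "e' \<in> hom1 K y x"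
    and "ff K (e' \<odot> e)" and "ff K (e \<odot> e')"
  shows "ff K e"
  unfolding ff_iff[OF e]
proof (intro allI ballI)
  fix z f g assume f: "f \<in> hom1 K z x" and g: "g \<in> hom1 K z x"
  let ?H = "hom2 K f g" and ?H' = "hom2 K (e \<odot> f) (e \<odot> g)"
    and ?H'' = "hom2 K (e' \<odot> (e \<odot> f)) (e' \<odot> (e \<odot> g))"
  have ef: "e \<odot> f \<in> hom1 K z y" and eg: "e \<odot> g \<in> hom1 K z y"
    using comp1_hom[OF f e] comp1_hom[OF g e] .
  have "bij_betw (\<lambda>\<alpha>. (e' \<odot> e) \<rhd> \<alpha>) ?H ?H''"
    using assms(3) f g comp1_assoc[OF f e e'] comp1_assoc[OF g e e']
    unfolding ff_iff[OF comp1_hom[OF e e']] by fastforce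
  then have bij: "bij_betw ((\<lambda>\<alpha>. e' \<rhd> \<alpha>) \<circ> (\<lambda>\<alpha>. e \<rhd> \<alpha>)) ?H ?H''"
    by (rule bij_betw_cong[THEN iffD1, rotated]) (simp add: whisker_left_comp1[OF f e e'])
  have "inj_on (\<lambda>\<alpha>. (e \<odot> e') \<rhd> \<alpha>) ?H'"
    using assms(4) ef eg unfolding ff_iff[OF comp1_hom[OF e' e]] by (blast dest: bij_betw_imp_inj_on)
  \<comment> \<open>Whiskering with \<open>e \<odot> e'\<close> is whiskering with \<open>e'\<close>
    followed by whiskering with \<open>e\<close>, so its injectivity passes to the map applied
    first.\<close>
  then have inj: "inj_on (\<lambda>\<alpha>. e' \<rhd> \<alpha>) ?H'"
    by (auto simp: inj_on_def whisker_left_comp1[OF ef e' e])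
  have sub: "(\<lambda>\<alpha>. e \<rhd> \<alpha>) ` ?H \<subseteq> ?H'" "(\<lambda>\<alpha>. e' \<rhd> \<alpha>) ` ?H' \<subseteq> ?H''"
    using whisker_left_hom[OF f e] whisker_left_hom[OF ef e'] by auto
  \<comment> \<open>The composite in \<open>bij\<close> is onto \<open>?H''\<close>, hence so is its
    last factor, whiskering with \<open>e'\<close>.\<close>
  have "?H'' = (\<lambda>\<alpha>. e' \<rhd> \<alpha>) ` (\<lambda>\<alpha>. e \<rhd> \<alpha>) ` ?H"
    using bij by (simp add: bij_betw_def image_comp)
  also have "\<dots> \<subseteq> (\<lambda>\<alpha>. e' \<rhd> \<alpha>) ` ?H'"
    using sub(1) by (rule image_mono)
  finally have "(\<lambda>\<alpha>. e' \<rhd> \<alpha>) ` ?H' = ?H''"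
    using sub(2) by (simp add: subset_antisym)
  with inj have "bij_betw (\<lambda>\<alpha>. e' \<rhd> \<alpha>) ?H' ?H''"
    by (simp add: bij_betw_def)
  from bij_betw_comp_iff2[OF this sub(1)] bij
  show "bij_betw (\<lambda>\<alpha>. e \<rhd> \<alpha>) ?H ?H'"
    by (rule iffD2)
qed

text \<open>Both composites with a pseudo-inverse are isomorphic to identities, hence fully
  faithful, so the previous lemma applies.\<close>

lemma ff_equivalence1:
  assumes "equivalence1 K e"
  shows "ff K e"
proof -
  obtain x y e' where e: "e \<in> hom1 K x y" and e': "e' \<in> hom1 K y x"
    and "isomorphic1 K (e' \<odot> e) (ident1 K x)" "isomorphic1 K (e \<odot> e') (ident1 K y)"
    using assms unfolding equivalence1_def by blast
  then show ?thesis
    using ff_if_ff_comp1[OF e e'] ff_isomorphic1 ident1_hom ff_ident1 isomorphic1_sym hom1_obj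
    by metis
qed

text \<open>Fullness lifts the inverse of \<open>w \<rhd> \<beta>\<close> to a candidate inverse of
  \<open>\<beta>\<close>. Faithfulness then gives the two inverse laws, since they hold after
  whiskering with \<open>w\<close>. In BF4 this makes the lift of an invertible 2-arrow
  invertible.\<close>

lemma ff_reflects_iso2:
  assumes w: "w \<in> hom1 K y z" and "ff K w" and f: "f \<in> hom1 K x y" and g: "g \<in> hom1 K x y"
    and \<beta>: "\<beta> \<in> hom2 K f g" and iso: "w \<rhd> \<beta> \<in> iso2 K (w \<odot> f) (w \<odot> g)"
  shows "\<beta> \<in> iso2 K f g"
proof -
  have bij: "bij_betw (\<lambda>\<alpha>. w \<rhd> \<alpha>) (hom2 K h k) (hom2 K (w \<odot> h) (w \<odot> k))"
    if "h \<in> hom1 K x y" "k \<in> hom1 K x y" for h k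
    using assms(2) that unfolding ff_iff[OF w] by blast
  obtain \<gamma> where \<gamma>: "\<gamma> \<in> iso2 K (w \<odot> g) (w \<odot> f)"
    "\<gamma> \<bullet> (w \<rhd> \<beta>) = ident2 K (w \<odot> f)" "(w \<rhd> \<beta>) \<bullet> \<gamma> = ident2 K (w \<odot> g)"
    using iso2E[OF iso] .
  obtain \<delta> where \<delta>: "\<delta> \<in> hom2 K g f" "w \<rhd> \<delta> = \<gamma>"
    using bij_betw_imp_surj_on[OF bij[OF g f]] iso2_hom2[OF \<gamma>(1)] by (metis imageE)
  have "w \<rhd> (\<delta> \<bullet> \<beta>) = w \<rhd> ident2 K f" "w \<rhd> (\<beta> \<bullet> \<delta>) = w \<rhd> ident2 K g"
    using \<gamma> \<delta> whisker_left_vcomp[OF f w \<beta> \<delta>(1)] whisker_left_vcomp[OF g w \<delta>(1) \<beta>]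
      whisker_left_ident2[OF f w] whisker_left_ident2[OF g w] by simp_all
  then have "\<delta> \<bullet> \<beta> = ident2 K f" "\<beta> \<bullet> \<delta> = ident2 K g"
    using bij_betw_imp_inj_on[OF bij[OF f f]] bij_betw_imp_inj_on[OF bij[OF g g]]
      vcomp_hom[OF \<beta> \<delta>(1)] vcomp_hom[OF \<delta>(1) \<beta>] ident2_hom1[OF f] ident2_hom1[OF g]
    by (auto dest: inj_onD)
  then show ?thesis
    unfolding iso2_def using \<beta> \<delta>(1) by blast
qed

section \<open>Locally split 1-arrows\<close>

lemma locally_split_iff:
  assumes "f \<in> hom1 K x y"
  shows "locally_split K J f \<longleftrightarrow> (\<exists>u. \<exists>q \<in> hom1 K u y. \<exists>s \<in> hom1 K u x.
    q \<in> J \<and> isomorphic1 K (f \<odot> s) q)"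
  using assms hom1_obj(1) unfolding locally_split_def by (fastforce simp: hom1_def)

lemma locally_split_isomorphic1:
  assumes f: "f \<in> hom1 K x y" and "locally_split K J f" and iso: "isomorphic1 K f g"
  shows "locally_split K J g"
proof -
  have g: "g \<in> hom1 K x y"
    using isomorphic1_hom1[OF iso f] .
  obtain u q s where s: "q \<in> hom1 K u y" "s \<in> hom1 K u x" "q \<in> J" "isomorphic1 K (f \<odot> s) q"
    using assms(2) unfolding locally_split_iff[OF f] by blast
  have "isomorphic1 K (g \<odot> s) q"
    using isomorphic1_trans[OF isomorphic1_sym[OF isomorphic1_comp1_right[OF iso f s(2)]] s(4)] .
  with s show ?thesis
    unfolding locally_split_iff[OF g] by blast
qed

end

section \<open>Covers and weak equivalences in a 2-site\<close>

locale two_site_loc = two_category +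
  fixes J
  assumes coverage: "ff_singleton_coverage K J"
begin

lemma cover_ident1: "x \<in> Obj K \<Longrightarrow> ident1 K x \<in> J"
  using coverage unfolding ff_singleton_coverage_def by blast

lemma cover_comp1:
  "\<lbrakk>p \<in> J; q \<in> J; p \<in> hom1 K x y; q \<in> hom1 K y z\<rbrakk> \<Longrightarrow> q \<odot> p \<in> J"
  using coverage unfolding ff_singleton_coverage_def by (simp add: hom1_def)

lemma cover_ff: "q \<in> J \<Longrightarrow> ff K q"
  using coverage unfolding ff_singleton_coverage_def by blast

lemma cover_pullback:
  assumes "q \<in> J" "q \<in> hom1 K u x" "f \<in> hom1 K y x"
  obtains v k h where "k \<in> hom1 K v y" "h \<in> hom1 K v u" "k \<in> J"
    "isomorphic1 K (q \<odot> h) (f \<odot> k)"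
  using coverage assms hom1_obj unfolding ff_singleton_coverage_def by blast

abbreviation "W \<equiv> weak_equivalences K J"

lemma weak_equivalence_iff:
  "w \<in> hom1 K x y \<Longrightarrow> w \<in> W \<longleftrightarrow> ff K w \<and> locally_split K J w"
  by (simp add: weak_equivalences_def hom1_arr)

text \<open>A cover is fully faithful by the coverage axioms, and it splits over itself with the
  identity of its source as section.\<close>

lemma cover_weak_equivalence:
  assumes "q \<in> J" "q \<in> hom1 K u x"
  shows "q \<in> W"
  using assms cover_ff ident1_hom[OF hom1_obj(1)[OF assms(2)]] comp1_ident_right[OF assms(2)]
    isomorphic1_refl[OF assms(2)]
  unfolding weak_equivalence_iff[OF assms(2)] locally_split_iff[OF assms(2)] by metis

lemma locally_split_comp1:
  assumes v: "v \<in> hom1 K x y" and w: "w \<in> hom1 K y z"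
    and "locally_split K J v" "locally_split K J w"
  shows "locally_split K J (w \<odot> v)"
proof -
  obtain u q s where s: "q \<in> hom1 K u z" "s \<in> hom1 K u y" "q \<in> J" "isomorphic1 K (w \<odot> s) q"
    using assms(4) unfolding locally_split_iff[OF w] by blast
  obtain u' p t where t: "p \<in> hom1 K u' y" "t \<in> hom1 K u' x" "p \<in> J" "isomorphic1 K (v \<odot> t) p"
    using assms(3) unfolding locally_split_iff[OF v] by blast
  \<comment> \<open>The cover \<open>p\<close> over which \<open>v\<close> splits is pulled back
    along the local section \<open>s\<close> of \<open>w\<close>. Over the refined cover
    \<open>q \<odot> k\<close> the composite \<open>w \<odot> v\<close> then has the section
    \<open>t \<odot> h\<close>, because \<open>v \<odot> t \<odot> h\<close> is isomorphic to
    \<open>p \<odot> h\<close> and so to \<open>s \<odot> k\<close>.\<close>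
  obtain d k h where h: "k \<in> hom1 K d u" "h \<in> hom1 K d u'" "k \<in> J"
    "isomorphic1 K (p \<odot> h) (s \<odot> k)"
    using cover_pullback[OF t(3,1) s(2)] .
  note vt = comp1_hom[OF t(2) v]
  have "isomorphic1 K (v \<odot> t \<odot> h) (p \<odot> h)"
    using isomorphic1_comp1_right[OF t(4) vt h(2)] comp1_assoc[OF h(2) t(2) v] by simp
  from isomorphic1_trans[OF this h(4)]
  have "isomorphic1 K (w \<odot> v \<odot> t \<odot> h) (w \<odot> s \<odot> k)"
    by (rule isomorphic1_comp1_left[OF _ comp1_hom[OF comp1_hom[OF h(2) t(2)] v] w])
  also have "isomorphic1 K (w \<odot> s \<odot> k) (q \<odot> k)"
    using isomorphic1_comp1_right[OF s(4) comp1_hom[OF s(2) w] h(1)] comp1_assoc[OF h(1) s(2) w]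
    by simp
  finally have "isomorphic1 K ((w \<odot> v) \<odot> t \<odot> h) (q \<odot> k)"
    using comp1_assoc[OF comp1_hom[OF h(2) t(2)] v w] by simp
  then show ?thesis
    unfolding locally_split_iff[OF comp1_hom[OF v w]]
    using comp1_hom[OF h(2) t(2)] comp1_hom[OF h(1) s(1)] cover_comp1[OF h(3) s(3) h(1) s(1)]
    by blast
qed

section \<open>The four conditions for a bicategory of fractions\<close>

lemma BF1_weak_equivalences: "BF1 K W"
  unfolding BF1_def
proof (intro allI impI)
  fix e assume equiv: "equivalence1 K e"
  then obtain x y e' where e: "e \<in> hom1 K x y" and e': "e' \<in> hom1 K y x"
    and iso: "isomorphic1 K (e \<odot> e') (ident1 K y)"
    unfolding equivalence1_def by blast
  note y = hom1_obj(2)[OF e]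
  \<comment> \<open>The pseudo-inverse \<open>e'\<close> is a section of \<open>e\<close> over the
    identity cover of \<open>y\<close>.\<close>
  have "locally_split K J e"
    unfolding locally_split_iff[OF e] using e' iso ident1_hom[OF y] cover_ident1[OF y] by blast
  then show "e \<in> W"
    unfolding weak_equivalence_iff[OF e] using ff_equivalence1[OF equiv] by blast
qed

lemma BF2_weak_equivalences: "BF2 K W"
  unfolding BF2_def
proof (intro conjI ballI impI)
  fix v w assume vw: "v \<in> W" "w \<in> W" "tgt K v = src K w"
  then have v: "v \<in> hom1 K (src K v) (src K w)" and w: "w \<in> hom1 K (src K w) (tgt K w)"
    by (auto simp: weak_equivalences_def hom1_def)
  show "w \<odot> v \<in> W"
    using vw(1,2) ff_comp1[OF v w] locally_split_comp1[OF v w]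
    unfolding weak_equivalence_iff[OF v] weak_equivalence_iff[OF w]
      weak_equivalence_iff[OF comp1_hom[OF v w]] by blast
next
  fix w f assume "w \<in> W" and iso: "isomorphic1 K w f"
  moreover from this have w: "w \<in> hom1 K (src K w) (tgt K w)"
    by (simp add: weak_equivalences_def hom1_def)
  ultimately show "f \<in> W"
    unfolding weak_equivalence_iff[OF w] weak_equivalence_iff[OF isomorphic1_hom1[OF iso w]]
    using ff_isomorphic1[OF w] locally_split_isomorphic1[OF w] by blast
qed

text \<open>The coverage axiom pulls back covers, not arbitrary weak equivalences. So a cover
  \<open>q\<close> over which \<open>w\<close> splits is pulled back along \<open>f\<close> in place
  of \<open>w\<close>, and its other leg \<open>h\<close> is composed with the section
  \<open>s\<close> to reach the source of \<open>w\<close>. The resulting \<open>v\<close> is even a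
  cover.\<close>

lemma BF3_weak_equivalences: "BF3 K W"
  unfolding BF3_def
proof (intro ballI impI)
  fix a a' c w f
  assume w: "w \<in> hom1 K a' a" and f: "f \<in> hom1 K c a" and "w \<in> W"
  then obtain u q s where s: "q \<in> hom1 K u a" "s \<in> hom1 K u a'" "q \<in> J" "isomorphic1 K (w \<odot> s) q"
    unfolding weak_equivalence_iff[OF w] locally_split_iff[OF w] by blast
  obtain p k h where h: "k \<in> hom1 K p c" "h \<in> hom1 K p u" "k \<in> J"
    "isomorphic1 K (q \<odot> h) (f \<odot> k)"
    using cover_pullback[OF s(3,1) f] .
  have "isomorphic1 K (w \<odot> s \<odot> h) (q \<odot> h)"
    using isomorphic1_comp1_right[OF s(4) comp1_hom[OF s(2) w] h(2)] comp1_assoc[OF h(2) s(2) w]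
    by simp
  from isomorphic1_trans[OF this h(4)]
  show "\<exists>p \<in> Obj K. \<exists>v \<in> hom1 K p c. \<exists>g \<in> hom1 K p a'. v \<in> W \<and> isomorphic1 K (w \<odot> g) (f \<odot> v)"
    using h(1) hom1_obj(1)[OF h(1)] comp1_hom[OF h(2) s(2)] cover_weak_equivalence[OF h(3,1)]
    by blast
qed

lemma BF4_weak_equivalences: "BF4 K W"
  unfolding BF4_def
proof (intro ballI impI)
  fix a a' b w f g \<alpha>
  assume b: "b \<in> Obj K" and w: "w \<in> hom1 K a' a" and f: "f \<in> hom1 K b a'"
    and g: "g \<in> hom1 K b a'" and \<alpha>: "\<alpha> \<in> hom2 K (w \<odot> f) (w \<odot> g)" and "w \<in> W"
  then have ffw: "ff K w"
    using weak_equivalence_iff[OF w] by blast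
  \<comment> \<open>The source \<open>z\<close> stays arbitrary because the bijection is applied
    twice: at \<open>b\<close> to lift \<open>\<alpha>\<close>, and at the source of a competing
    \<open>v'\<close> to compare solutions.\<close>
  then have bij: "bij_betw (\<lambda>\<alpha>. w \<rhd> \<alpha>) (hom2 K h k) (hom2 K (w \<odot> h) (w \<odot> k))"
    if "h \<in> hom1 K z a'" "k \<in> hom1 K z a'" for z h k
    using that unfolding ff_iff[OF w] by blast
  obtain \<beta> where \<beta>: "\<beta> \<in> hom2 K f g" "w \<rhd> \<beta> = \<alpha>"
    using bij_betw_imp_surj_on[OF bij[OF f g]] \<alpha> by (metis imageE)
  \<comment> \<open>The lift \<open>\<beta>\<close> already lives over \<open>b\<close>, so the
    identity serves as \<open>v\<close>; the strict unit laws turn \<open>f \<odot> ?v\<close> and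
    \<open>g \<odot> ?v\<close> into \<open>f\<close> and \<open>g\<close>.\<close>
  let ?v = "ident1 K b"
  note v = ident1_hom[OF b]
  note fv = comp1_ident_right[OF f] and gv = comp1_ident_right[OF g]
  have "?v \<in> W"
    using cover_weak_equivalence[OF cover_ident1[OF b] v] .
  moreover have "\<alpha> \<lhd> ?v = \<alpha>"
    unfolding whisker_right_def using hcomp_ident_right[OF comp1_hom[OF f w] \<alpha>] .
  ultimately have "BF4_pair K W w f g \<alpha> ?v \<beta>"
    unfolding BF4_pair_def fv gv using v f \<beta> by (simp add: hom1_def)
  moreover have "\<beta> \<in> iso2 K (f \<odot> ?v) (g \<odot> ?v)" if "\<alpha> \<in> iso2 K (w \<odot> f) (w \<odot> g)"
    unfolding fv gv using ff_reflects_iso2[OF w ffw f g \<beta>(1)] \<beta>(2) that by simp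
  moreover have "\<exists>d \<in> Obj K. \<exists>u \<in> hom1 K d (src K ?v). \<exists>u' \<in> hom1 K d (src K v').
      ?v \<odot> u \<in> W \<and> v' \<odot> u' \<in> W \<and>
      (\<exists>\<epsilon> \<in> iso2 K (?v \<odot> u) (v' \<odot> u'). (g \<rhd> \<epsilon>) \<bullet> (\<beta> \<lhd> u) = (\<beta>' \<lhd> u') \<bullet> (f \<rhd> \<epsilon>))"
    if pair: "BF4_pair K W w f g \<alpha> v' \<beta>'" for v' \<beta>'
  proof -
    \<comment> \<open>The comparison uses \<open>u = v'\<close>, \<open>u' = ident1 K ?d\<close> and
      \<open>\<epsilon> = ident2 K v'\<close>: both \<open>?v \<odot> v'\<close> and
      \<open>v' \<odot> ident1 K ?d\<close> are equal to \<open>v'\<close>. The compatibility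
      equation then reduces to \<open>\<beta> \<lhd> v' = \<beta>'\<close>.\<close>
    let ?d = "src K v'"
    have v': "v' \<in> hom1 K ?d b" "v' \<in> W"
      and \<beta>': "\<beta>' \<in> hom2 K (f \<odot> v') (g \<odot> v')" "\<alpha> \<lhd> v' = w \<rhd> \<beta>'"
      using pair f unfolding BF4_pair_def by (auto simp: hom1_def)
    note d = hom1_obj(1)[OF v'(1)]
    note fv' = comp1_hom[OF v'(1) f] and gv' = comp1_hom[OF v'(1) g]
    have hom: "\<beta> \<lhd> v' \<in> hom2 K (f \<odot> v') (g \<odot> v')"
      using whisker_right_hom[OF v'(1) f \<beta>(1)] .
    \<comment> \<open>Both sides are equal to \<open>\<alpha> \<lhd> v'\<close>; faithfulness of
      \<open>w\<close> will cancel the whiskering.\<close>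
    have "w \<rhd> (\<beta> \<lhd> v') = w \<rhd> \<beta>'"
      using whisker_left_right[OF v'(1) f w \<beta>(1)] \<beta>(2) \<beta>'(2) by simp
    then have eq: "\<beta> \<lhd> v' = \<beta>'"
      using bij_betw_imp_inj_on[OF bij[OF fv' gv']] hom \<beta>'(1) by (auto dest: inj_onD)
    have "\<beta>' \<lhd> ident1 K ?d = \<beta>'"
      unfolding whisker_right_def using hcomp_ident_right[OF fv' \<beta>'(1)] .
    then have "(g \<rhd> ident2 K v') \<bullet> (\<beta> \<lhd> v') = (\<beta>' \<lhd> ident1 K ?d) \<bullet> (f \<rhd> ident2 K v')"
      using eq whisker_left_ident2[OF v'(1) f] whisker_left_ident2[OF v'(1) g]
        vcomp_ident_left[OF \<beta>'(1)] vcomp_ident_right[OF \<beta>'(1)] by simp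
    moreover have "v' \<in> hom1 K ?d (src K ?v)"
      using v v'(1) by (simp add: hom1_def)
    ultimately show ?thesis
      using d v' ident1_hom[OF d] ident2_iso2[OF v'(1)] comp1_ident_left[OF v'(1)]
        comp1_ident_right[OF v'(1)] by metis
  qed
  ultimately show "\<exists>v \<beta>. BF4_pair K W w f g \<alpha> v \<beta> \<and>
      (\<alpha> \<in> iso2 K (w \<odot> f) (w \<odot> g) \<longrightarrow> \<beta> \<in> iso2 K (f \<odot> v) (g \<odot> v)) \<and>
      (\<forall>v' \<beta>'. BF4_pair K W w f g \<alpha> v' \<beta>' \<longrightarrow>
        (\<exists>d \<in> Obj K. \<exists>u \<in> hom1 K d (src K v). \<exists>u' \<in> hom1 K d (src K v').
          v \<odot> u \<in> W \<and> v' \<odot> u' \<in> W \<and>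
          (\<exists>\<epsilon> \<in> iso2 K (v \<odot> u) (v' \<odot> u'). (g \<rhd> \<epsilon>) \<bullet> (\<beta> \<lhd> u) = (\<beta>' \<lhd> u') \<bullet> (f \<rhd> \<epsilon>))))"
    by blast
qed

end

theorem theorem3p1:
  fixes K :: "('o, 'a, 'c) two_cat"
    and J :: "'a set"
  assumes "two_site K J"
  shows "admits_bicategory_of_fractions K (weak_equivalences K J)"
proof -
  interpret two_site_loc K J
    using assms
    by (simp add: two_site_def two_site_loc_def two_site_loc_axioms_def)
  show ?thesis
    unfolding admits_bicategory_of_fractions_def
    using BF1_weak_equivalences BF2_weak_equivalences BF3_weak_equivalences BF4_weak_equivalences
    by (auto simp: weak_equivalences_def)
qed

end
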